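(* Let $A,B_1,\ldots,B_m\in\mathbb{C}^{d\times d}$, let $\{\xi_{n,k}: n\ge 1,\ 1\le k\le m\}$ be independent real-valued random variables with $\mathbb{E}\xi_{n,k}=0$ and $\mathbb{E}\xi_{n,k}^2=1$, and let $\mathbf{u},\mathbf{v}\in\mathbb{C}^d$ be non-random. Define $\mathbb{C}^d$-valued random sequences by \[ \mathbf{x}(n+1)=A\mathbf{x}(n)+\sum_{k=1}^m B_k\mathbf{x}(n)\xi_{n+1,k},\ \mathbf{x}(0)=\mathbf{u};\qquad \mathbf{y}(n+1)=A\mathbf{y}(n)+\sum_{k=1}^m B_k\mathbf{y}(n)\xi_{n+1,k},\ \mathbf{y}(0)=\mathbf{v}. \] Let $V(n)=\mathbb{E}\,\mathbf{x}(n)\mathbf{y}^*(n)$, $\mathbf{U}(n)=\mathrm{vec}(V(n))$ and $r_x(n)=\mathbb{E}|\mathbf{x}(n)|^2$. Then \[ \mathbf{U}(n)=D_{A,B}^n\,\mathbf{U}(0),\qquad D_{A,B}=\overline{A}\otimes A+\sum_{k=1}^m\overline{B}_k\otimes B_k, \] and \[ |\mathbf{u}|^2\gamma^n\le r_x(n)\le |\mathbf{u}|^2\beta^n \quad\text{for all } n\ge 0, \] where $\gamma$ and $\beta$ are the smallest and largest eigenvalues of the non-negative Hermitian matrix $N_{A,B}=A^*A+\sum_{k=1}^m B_k^*B_k$.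
   Context: For $X\in\mathbb{C}^{d\times d}$, $\mathrm{vec}(X)\in\mathbb{C}^{d^2}$ is the column vector obtained by stacking the columns of $X$ left to right: $(X_{11},\ldots,X_{d1},X_{12},\ldots,X_{d2},\ldots,X_{1d},\ldots,X_{dd})^\top$. $\overline{X}$ is entrywise conjugate, $X^*$ conjugate transpose, $\otimes$ the Kronecker product, $|\cdot|$ the Euclidean norm. *)

theory Defs
  imports "HOL-Analysis.Analysis" "HOL-Probability.Probability"
begin

(* Entrywise complex conjugate of a matrix:  \<overline>X *)
definition cmat_conj :: "complex^'n^'m \<Rightarrow> complex^'n^'m" where
  "cmat_conj X = (\<chi> i j. cnj (X $ i $ j))"

(* Conjugate transpose X^* *)
definition cmat_adj :: "complex^'n^'m \<Rightarrow> complex^'m^'n" where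
  "cmat_adj X = (\<chi> i j. cnj (X $ j $ i))"

(* vec: column stacking.  C^{d^2} is indexed by pairs (p,q) ordered as
   position (p-1)d+q, i.e. p = column (block) index, q = row index:
   vec(X) at (p,q) is X_{q p}. *)
definition cvec :: "complex^'d^'d \<Rightarrow> complex^('d \<times> 'd)" where
  "cvec X = (\<chi> pq. X $ snd pq $ fst pq)"

(* Kronecker product with the same index convention:
   (P \<otimes> Q) at row (a,b), column (c,e) equals P_{ac} Q_{be}. *)
definition kron :: "complex^'d^'d \<Rightarrow> complex^'d^'d \<Rightarrow> complex^('d \<times> 'd)^('d \<times> 'd)" where
  "kron P Q = (\<chi> ab ce. P $ fst ab $ fst ce * Q $ snd ab $ snd ce)"

(* The random recursion x(n+1) = A x(n) + \<Sum>_{k=1}^m B_k x(n) \<xi>_{n+1,k}, x(0) = u *)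
primrec traj :: "complex^'d^'d \<Rightarrow> (nat \<Rightarrow> complex^'d^'d) \<Rightarrow> nat \<Rightarrow>
    (nat \<Rightarrow> nat \<Rightarrow> 'a \<Rightarrow> real) \<Rightarrow> complex^'d \<Rightarrow> nat \<Rightarrow> 'a \<Rightarrow> complex^'d" where
  "traj A B m \<xi> u 0 \<omega> = u"
| "traj A B m \<xi> u (Suc n) \<omega> =
     A *v traj A B m \<xi> u n \<omega>
     + (\<Sum>k\<in>{1..m}. complex_of_real (\<xi> (Suc n) k \<omega>) *s (B k *v traj A B m \<xi> u n \<omega>))"

(* V(n) = E x(n) y(n)^*  (entrywise expectation) *)
definition covmat :: "'a measure \<Rightarrow> ('a \<Rightarrow> complex^'d) \<Rightarrow> ('a \<Rightarrow> complex^'d) \<Rightarrow> complex^'d^'d" where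
  "covmat M x y = (\<chi> i j. integral\<^sup>L M (\<lambda>\<omega>. x \<omega> $ i * cnj (y \<omega> $ j)))"

(* real eigenvalues of a complex square matrix *)
definition real_eigenvalues :: "complex^'d^'d \<Rightarrow> real set" where
  "real_eigenvalues N = {e. \<exists>x. x \<noteq> 0 \<and> N *v x = complex_of_real e *s x}"

end

theory Submission
  imports Defs
begin

(* Put \<xi>_{n,0} = 1 and B_0 = A, so that x(n+1) = \<Sum>_{k=0}^m \<xi>_{n+1,k} B_k x(n).  The fresh noise
   \<xi>_{n+1,.} is independent of (x(n), y(n)), which are functions of the earlier noise, and
   E \<xi>_{n+1,k} \<xi>_{n+1,l} = \<delta>_{kl}; so all cross terms vanish and V(n+1) = \<Sum>_k B_k V(n) B_k^*.
   The identity vec(P X Q^* ) = (conj Q \<otimes> P) vec X turns this into U(n+1) = D_{A,B} U(n).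
   Taking traces with u = v gives r_x(n+1) = E x(n)^* N_{A,B} x(n).  The Hermitian form of N_{A,B}
   lies between \<gamma>|z|^2 and \<beta>|z|^2, because a maximiser (minimiser) of the form on the unit sphere
   is an eigenvector; hence \<gamma> r_x(n) \<le> r_x(n+1) \<le> \<beta> r_x(n), with \<gamma> \<ge> 0 as the form is a sum
   of squares. *)

section \<open>Hermitian matrices and their extreme eigenvalues\<close>

definition cinner :: "complex^'n \<Rightarrow> complex^'n \<Rightarrow> complex" where
  "cinner x y = (\<Sum>i\<in>UNIV. cnj (x $ i) * y $ i)"

lemma cinner_add_left: "cinner (x + y) z = cinner x z + cinner y z"
  by (simp add: cinner_def distrib_right sum.distrib)

lemma cinner_add_right: "cinner z (x + y) = cinner z x + cinner z y"
  by (simp add: cinner_def distrib_left sum.distrib)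

lemma cinner_diff_right: "cinner z (x - y) = cinner z x - cinner z y"
  by (simp add: cinner_def right_diff_distrib sum_subtractf)

lemma cinner_scale_left: "cinner (c *s x) z = cnj c * cinner x z"
  by (simp add: cinner_def sum_distrib_left mult.assoc)

lemma cinner_scale_right: "cinner z (c *s x) = c * cinner z x"
  by (simp add: cinner_def sum_distrib_left mult.left_commute)

lemma cinner_sum_right: "cinner z (\<Sum>k\<in>S. f k) = (\<Sum>k\<in>S. cinner z (f k))"
  by (simp add: cinner_def sum_distrib_left sum.swap[of _ S])

lemma cinner_commute: "cinner y x = cnj (cinner x y)"
  by (simp add: cinner_def mult.commute)

lemma cinner_self: "cinner x x = of_real ((norm x)\<^sup>2)"
proof -
  have norm_sq: "(norm x)\<^sup>2 = (\<Sum>i\<in>UNIV. (norm (x $ i))\<^sup>2)"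
    by (simp add: power2_norm_eq_inner inner_vec_def)
  show ?thesis
    unfolding norm_sq cinner_def of_real_sum complex_norm_square by (simp add: mult.commute)
qed

lemma inner_eq_Re_cinner: "x \<bullet> y = Re (cinner x y)"
  by (simp add: inner_vec_def cinner_def inner_complex_def Re_sum)

lemma cinner_adj: "cinner x (cmat_adj P *v y) = cinner (P *v x) y"
proof -
  have "cinner x (cmat_adj P *v y) = (\<Sum>i\<in>UNIV. \<Sum>j\<in>UNIV. cnj (x$i) * (cnj (P$j$i) * y$j))"
    unfolding cinner_def cmat_adj_def matrix_vector_mult_def by (simp add: sum_distrib_left)
  also have "\<dots> = (\<Sum>j\<in>UNIV. \<Sum>i\<in>UNIV. cnj (P$j$i * x$i) * y$j)"
    by (subst sum.swap) (simp add: mult_ac)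
  also have "\<dots> = cinner (P *v x) y"
    unfolding cinner_def matrix_vector_mult_def by (simp add: sum_distrib_right)
  finally show ?thesis .
qed

lemma matrix_vector_mult_scale: "P *v (c *s x) = c *s (P *v (x::complex^'n))"
  by (simp add: vec_eq_iff matrix_vector_mult_def sum_distrib_left mult.left_commute)

lemma matrix_vector_mult_sum_left: "(\<Sum>k\<in>S. P k) *v (x::complex^'n) = (\<Sum>k\<in>S. P k *v x)"
  by (induction S rule: infinite_finite_induct) (auto simp: matrix_vector_mult_add_rdistrib)

lemma scaleR_eq_scale_of_real: "c *\<^sub>R (x::complex^'n) = of_real c *s x"
  by (simp add: vec_eq_iff) (simp add: scaleR_conv_of_real)

definition hermitian :: "complex^'n^'n \<Rightarrow> bool" where
  "hermitian N \<longleftrightarrow> cmat_adj N = N"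

lemma hermitian_add: "hermitian N \<Longrightarrow> hermitian K \<Longrightarrow> hermitian (N + K)"
  by (simp add: hermitian_def cmat_adj_def vec_eq_iff)

lemma hermitian_zero: "hermitian 0"
  by (simp add: hermitian_def cmat_adj_def vec_eq_iff)

lemma hermitian_sum: "(\<And>k. k \<in> S \<Longrightarrow> hermitian (N k)) \<Longrightarrow> hermitian (\<Sum>k\<in>S. N k)"
  by (induction S rule: infinite_finite_induct) (simp_all add: hermitian_zero hermitian_add)

lemma hermitian_uminus: "hermitian N \<Longrightarrow> hermitian (- N)"
  by (simp add: hermitian_def cmat_adj_def vec_eq_iff)

lemma hermitian_adj_mult_self: "hermitian (cmat_adj P ** P)"
  by (simp add: hermitian_def cmat_adj_def matrix_matrix_mult_def vec_eq_iff mult.commute)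

lemma hermitian_cinner_commute:
  assumes "hermitian N"
  shows "cinner y (N *v x) = cnj (cinner x (N *v y))"
  using cinner_adj[of y N x] cinner_commute[of "N *v y" x] assms by (simp add: hermitian_def)

definition cquad_form :: "complex^'n^'n \<Rightarrow> complex^'n \<Rightarrow> real" where
  "cquad_form N x = Re (cinner x (N *v x))"

lemma hermitian_cinner_self:
  assumes "hermitian N"
  shows "cinner x (N *v x) = of_real (cquad_form N x)"
proof -
  have "Im (cinner x (N *v x)) = - Im (cinner x (N *v x))"
    using arg_cong[OF hermitian_cinner_commute[OF assms, of x x], of Im] by simp
  then have "Im (cinner x (N *v x)) = 0"
    by linarith
  then show ?thesis
    by (simp add: cquad_form_def complex_eq_iff)
qed

lemma cquad_form_diff: "cquad_form (N - K) x = cquad_form N x - cquad_form K x"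
  by (simp add: cquad_form_def matrix_vector_mult_diff_rdistrib cinner_diff_right)

lemma cquad_form_sum: "cquad_form (\<Sum>k\<in>S. N k) x = (\<Sum>k\<in>S. cquad_form (N k) x)"
  by (simp add: cquad_form_def matrix_vector_mult_sum_left cinner_sum_right Re_sum)

lemma cquad_form_adj_mult_self: "cquad_form (cmat_adj P ** P) x = (norm (P *v x))\<^sup>2"
  by (simp add: cquad_form_def flip: matrix_vector_mul_assoc add: cinner_adj cinner_self)

lemma cquad_form_uminus: "cquad_form (- N) x = - cquad_form N x"
  by (simp add: cquad_form_def cinner_def matrix_vector_mult_def sum_negf)

lemma cquad_form_scaleR: "cquad_form N (c *\<^sub>R x) = c\<^sup>2 * cquad_form N x"
  by (simp add: cquad_form_def matrix_vector_mult_scale scaleR_eq_scale_of_real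
      cinner_scale_left cinner_scale_right power2_eq_square)

lemma continuous_on_cquad_form: "continuous_on S (cquad_form N)"
  unfolding cquad_form_def cinner_def matrix_vector_mult_def vec_lambda_beta
  by (intro continuous_intros)

lemma cquad_form_eigenvector:
  assumes "N *v x = of_real e *s x"
  shows "cquad_form N x = e * (norm x)\<^sup>2"
  using assms by (simp add: cquad_form_def cinner_scale_right cinner_self)

lemma mat_vector_mult: "mat c *v x = c *s (x::complex^'n)"
  by (vector matrix_vector_mult_def mat_def) (simp add: if_distrib if_distribR cong del: if_weak_cong)

lemma hermitian_mat_of_real: "hermitian (mat (of_real c))"
  by (simp add: hermitian_def cmat_adj_def mat_def vec_eq_iff)

lemma hermitian_diff: "hermitian N \<Longrightarrow> hermitian K \<Longrightarrow> hermitian (N - K)"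
  by (simp add: hermitian_def cmat_adj_def vec_eq_iff)

lemma cquad_form_mat_of_real: "cquad_form (mat (of_real c)) x = c * (norm x)\<^sup>2"
  by (simp add: cquad_form_def mat_vector_mult cinner_scale_right cinner_self)

lemma quadratic_nonpos_imp_linear_coeff_nonpos:
  fixes W a :: real
  assumes "\<And>t. 2 * t * W + t\<^sup>2 * a \<le> 0"
  shows "W \<le> 0"
proof (rule ccontr)
  assume "\<not> W \<le> 0"
  define t where "t = W / (\<bar>a\<bar> + 1)"
  have t_pos: "t > 0"
    using \<open>\<not> W \<le> 0\<close> by (simp add: t_def add_pos_nonneg)
  have "t * \<bar>a\<bar> \<le> W"
    using \<open>\<not> W \<le> 0\<close> by (simp add: t_def field_simps)
  then have "t * (t * \<bar>a\<bar>) \<le> t * W"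
    using t_pos by (simp add: mult_left_mono)
  moreover have "t\<^sup>2 * (- \<bar>a\<bar>) \<le> t\<^sup>2 * a"
    by (intro mult_left_mono) simp_all
  ultimately have "t * W \<le> 2 * t * W + t\<^sup>2 * a"
    by (simp add: power2_eq_square algebra_simps)
  with assms[of t] have "t * W \<le> 0"
    by linarith
  with t_pos \<open>\<not> W \<le> 0\<close> show False
    by (simp add: mult_le_0_iff)
qed

lemma hermitian_cquad_form_along_image:
  assumes "hermitian L" and "cquad_form L x = 0"
  shows "cquad_form L (x + t *\<^sub>R (L *v x))
           = 2 * t * (norm (L *v x))\<^sup>2 + t\<^sup>2 * cquad_form L (L *v x)"
proof -
  define w where "w = L *v x"
  define c where "c = (of_real t :: complex)"
  have z: "x + t *\<^sub>R w = x + c *s w"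
    by (simp add: c_def scaleR_eq_scale_of_real)
  have xx: "cinner x (L *v x) = 0"
    using hermitian_cinner_self[OF assms(1)] assms(2) by simp
  have wx: "cinner w (L *v x) = of_real ((norm w)\<^sup>2)"
    by (simp add: w_def cinner_self)
  have xw: "cinner x (L *v w) = of_real ((norm w)\<^sup>2)"
    using hermitian_cinner_commute[OF assms(1), of x w] wx by simp
  have "cinner (x + c *s w) (L *v (x + c *s w))
      = cinner x (L *v x) + c * cinner x (L *v w) + cnj c * cinner w (L *v x)
        + cnj c * c * cinner w (L *v w)"
    by (simp add: matrix_vector_right_distrib matrix_vector_mult_scale cinner_add_left
        cinner_add_right cinner_scale_left cinner_scale_right algebra_simps)
  also have "\<dots> = of_real (2 * t * (norm w)\<^sup>2 + t\<^sup>2 * cquad_form L w)"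
    using hermitian_cinner_self[OF assms(1), of w]
    by (simp add: xx xw wx c_def power2_eq_square algebra_simps)
  finally have "cquad_form L (x + c *s w) = 2 * t * (norm w)\<^sup>2 + t\<^sup>2 * cquad_form L w"
    by (simp only: cquad_form_def[of L "x + c *s w"] Re_complex_of_real)
  then show ?thesis
    by (simp only: z flip: w_def)
qed

lemma hermitian_nonpos_form_kernel:
  assumes "hermitian L" and "\<And>z. cquad_form L z \<le> 0" and "cquad_form L x = 0"
  shows "L *v x = 0"
proof -
  have "(norm (L *v x))\<^sup>2 \<le> 0"
  proof (rule quadratic_nonpos_imp_linear_coeff_nonpos)
    show "2 * t * (norm (L *v x))\<^sup>2 + t\<^sup>2 * cquad_form L (L *v x) \<le> 0" for t
      using assms(2)[of "x + t *\<^sub>R (L *v x)"] hermitian_cquad_form_along_image[OF assms(1,3)]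
      by simp
  qed
  then show ?thesis
    by simp
qed

lemma hermitian_maximizer_eigenvector:
  assumes "hermitian N" and "\<And>z. cquad_form N z \<le> \<mu> * (norm z)\<^sup>2"
    and "cquad_form N x = \<mu> * (norm x)\<^sup>2"
  shows "N *v x = of_real \<mu> *s x"
proof -
  let ?L = "N - mat (of_real \<mu>)"
  have "?L *v x = 0"
    using assms by (intro hermitian_nonpos_form_kernel)
      (simp_all add: hermitian_diff hermitian_mat_of_real cquad_form_diff cquad_form_mat_of_real)
  then show ?thesis
    by (simp add: matrix_vector_mult_diff_rdistrib mat_vector_mult)
qed

lemma hermitian_minimizer_eigenvector:
  assumes "hermitian N" and "\<And>z. \<mu> * (norm z)\<^sup>2 \<le> cquad_form N z"
    and "cquad_form N x = \<mu> * (norm x)\<^sup>2"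
  shows "N *v x = of_real \<mu> *s x"
proof -
  have "(- N) *v x = of_real (- \<mu>) *s x"
    using assms by (intro hermitian_maximizer_eigenvector)
      (simp_all add: hermitian_uminus cquad_form_uminus)
  then show ?thesis
    by (simp add: vec_eq_iff matrix_vector_mult_def sum_negf)
qed

lemma cquad_form_attains_max:
  "\<exists>x::complex^'n. norm x = 1 \<and> (\<forall>z. cquad_form N z \<le> cquad_form N x * (norm z)\<^sup>2)"
proof -
  obtain x :: "complex^'n" where x: "x \<in> sphere 0 1"
    and max: "\<And>y. y \<in> sphere 0 1 \<Longrightarrow> cquad_form N y \<le> cquad_form N x"
    using continuous_attains_sup[OF compact_sphere _ continuous_on_cquad_form, of 0 1 N] by auto
  have "cquad_form N z \<le> cquad_form N x * (norm z)\<^sup>2" for z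
  proof (cases "z = 0")
    case True
    then show ?thesis
      by (simp add: cquad_form_def cinner_def)
  next
    case False
    have "cquad_form N z = (norm z)\<^sup>2 * cquad_form N ((1 / norm z) *\<^sub>R z)"
      using False by (simp flip: cquad_form_scaleR)
    also have "\<dots> \<le> (norm z)\<^sup>2 * cquad_form N x"
      using False by (intro mult_left_mono max) simp_all
    finally show ?thesis
      by (simp add: mult.commute)
  qed
  with x show ?thesis
    by auto
qed

lemma cquad_form_attains_min:
  "\<exists>x::complex^'n. norm x = 1 \<and> (\<forall>z. cquad_form N x * (norm z)\<^sup>2 \<le> cquad_form N z)"
  using cquad_form_attains_max[of "- N"] by (simp add: cquad_form_uminus)

lemma hermitian_top_eigenvalue:
  fixes N :: "complex^'n^'n"
  assumes "hermitian N"
  obtains e where "e \<in> real_eigenvalues N" and "\<And>z::complex^'n. cquad_form N z \<le> e * (norm z)\<^sup>2"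
proof -
  obtain x :: "complex^'n" where x: "norm x = 1" "\<And>z. cquad_form N z \<le> cquad_form N x * (norm z)\<^sup>2"
    using cquad_form_attains_max by blast
  have "N *v x = of_real (cquad_form N x) *s x"
    using x by (intro hermitian_maximizer_eigenvector[OF assms]) simp_all
  moreover have "x \<noteq> 0"
    using x(1) by auto
  ultimately have "cquad_form N x \<in> real_eigenvalues N"
    unfolding real_eigenvalues_def by blast
  with x show thesis
    using that by blast
qed

lemma hermitian_bottom_eigenvalue:
  fixes N :: "complex^'n^'n"
  assumes "hermitian N"
  obtains e where "e \<in> real_eigenvalues N" and "\<And>z::complex^'n. e * (norm z)\<^sup>2 \<le> cquad_form N z"
proof -
  obtain x :: "complex^'n" where x: "norm x = 1" "\<And>z. cquad_form N x * (norm z)\<^sup>2 \<le> cquad_form N z"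
    using cquad_form_attains_min by blast
  have "N *v x = of_real (cquad_form N x) *s x"
    using x by (intro hermitian_minimizer_eigenvector[OF assms]) simp_all
  moreover have "x \<noteq> 0"
    using x(1) by auto
  ultimately have "cquad_form N x \<in> real_eigenvalues N"
    unfolding real_eigenvalues_def by blast
  with x show thesis
    using that by blast
qed

lemma hermitian_eigenvectors_orthogonal:
  assumes "hermitian N" and "N *v x = of_real e *s x" and "N *v y = of_real f *s y" and "e \<noteq> f"
  shows "cinner x y = 0"
proof -
  have "of_real f * cinner x y = cinner x (N *v y)"
    using assms(3) by (simp add: cinner_scale_right)
  also have "\<dots> = cnj (cinner y (N *v x))"
    using hermitian_cinner_commute[OF assms(1), of x y] .
  also have "\<dots> = of_real e * cinner x y"
    using assms(2) cinner_commute[of x y] by (simp add: cinner_scale_right)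
  finally have "(of_real f - of_real e) * cinner x y = 0"
    by (simp add: algebra_simps)
  with assms(4) show ?thesis
    by simp
qed

lemma finite_real_eigenvalues_hermitian:
  assumes "hermitian (N :: complex^'n^'n)"
  shows "finite (real_eigenvalues N)"
proof -
  let ?E = "real_eigenvalues N"
  define v where "v e = (SOME x::complex^'n. x \<noteq> 0 \<and> N *v x = of_real e *s x)" for e
  have v: "v e \<noteq> 0 \<and> N *v v e = of_real e *s v e" if "e \<in> ?E" for e
    using that unfolding real_eigenvalues_def v_def by (rule CollectE) (rule someI_ex)
  have orth: "cinner (v e) (v f) = 0" if "e \<in> ?E" "f \<in> ?E" "e \<noteq> f" for e f
    using hermitian_eigenvectors_orthogonal[OF assms] v that by blast
  have "inj_on v ?E"
  proof (rule inj_onI, rule ccontr)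
    fix e f assume "e \<in> ?E" "f \<in> ?E" "v e = v f" "e \<noteq> f"
    then have "cinner (v e) (v e) = 0"
      using orth by metis
    with v[OF \<open>e \<in> ?E\<close>] show False
      by (simp add: cinner_self)
  qed
  moreover have "independent (v ` ?E)"
  proof (rule pairwise_orthogonal_independent)
    show "pairwise orthogonal (v ` ?E)"
    proof (rule pairwiseI, clarify)
      fix e f assume "e \<in> ?E" "f \<in> ?E" "v e \<noteq> v f"
      then have "e \<noteq> f"
        by blast
      with orth[of e f] \<open>e \<in> ?E\<close> \<open>f \<in> ?E\<close> show "orthogonal (v e) (v f)"
        by (simp add: orthogonal_def inner_eq_Re_cinner)
    qed
    show "0 \<notin> v ` ?E"
      using v by force
  qed
  then have "finite (v ` ?E)"
    using independent_bound by blast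
  ultimately show ?thesis
    using finite_imageD by blast
qed

lemma hermitian_cquad_form_le_Max_eigenvalue:
  assumes "hermitian N"
  shows "cquad_form N z \<le> Max (real_eigenvalues N) * (norm z)\<^sup>2"
proof -
  obtain e where e: "e \<in> real_eigenvalues N" "\<And>z. cquad_form N z \<le> e * (norm z)\<^sup>2"
    using hermitian_top_eigenvalue[OF assms] by blast
  have "e \<le> Max (real_eigenvalues N)"
    using e(1) finite_real_eigenvalues_hermitian[OF assms] by simp
  then have "e * (norm z)\<^sup>2 \<le> Max (real_eigenvalues N) * (norm z)\<^sup>2"
    by (simp add: mult_right_mono)
  with e(2)[of z] show ?thesis
    by (rule order_trans)
qed

lemma hermitian_Min_eigenvalue_le_cquad_form:
  assumes "hermitian N"
  shows "Min (real_eigenvalues N) * (norm z)\<^sup>2 \<le> cquad_form N z"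
proof -
  obtain e where e: "e \<in> real_eigenvalues N" "\<And>z. e * (norm z)\<^sup>2 \<le> cquad_form N z"
    using hermitian_bottom_eigenvalue[OF assms] by blast
  have "Min (real_eigenvalues N) \<le> e"
    using e(1) finite_real_eigenvalues_hermitian[OF assms] by simp
  then have "Min (real_eigenvalues N) * (norm z)\<^sup>2 \<le> e * (norm z)\<^sup>2"
    by (simp add: mult_right_mono)
  also have "\<dots> \<le> cquad_form N z"
    by (rule e(2))
  finally show ?thesis .
qed

lemma hermitian_Min_le_Max_eigenvalue:
  assumes "hermitian N"
  shows "Min (real_eigenvalues N) \<le> Max (real_eigenvalues N)"
proof -
  obtain e where "e \<in> real_eigenvalues N"
    using hermitian_top_eigenvalue[OF assms] by blast
  with finite_real_eigenvalues_hermitian[OF assms] show ?thesis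
    using Min_le Max_ge by (metis order_trans)
qed

lemma nonneg_Min_eigenvalue:
  assumes "hermitian N" and "\<And>z. 0 \<le> cquad_form N z"
  shows "0 \<le> Min (real_eigenvalues N)"
proof -
  obtain e where e: "e \<in> real_eigenvalues N"
    using hermitian_top_eigenvalue[OF assms(1)] by blast
  then have "Min (real_eigenvalues N) \<in> real_eigenvalues N"
    using finite_real_eigenvalues_hermitian[OF assms(1)] by (intro Min_in) auto
  then obtain x where x: "x \<noteq> 0" "N *v x = of_real (Min (real_eigenvalues N)) *s x"
    by (auto simp: real_eigenvalues_def)
  have "0 \<le> Min (real_eigenvalues N) * (norm x)\<^sup>2"
    using assms(2)[of x] cquad_form_eigenvector[OF x(2)] by simp
  with x(1) show ?thesis
    by (simp add: zero_le_mult_iff)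
qed

section \<open>Second moments of random vectors\<close>

lemma borel_measurable_cnj [measurable (raw)]:
  fixes f :: "'a \<Rightarrow> complex"
  assumes "f \<in> borel_measurable N"
  shows "(\<lambda>x. cnj (f x)) \<in> borel_measurable N"
  using measurable_compose[OF assms borel_measurable_continuous_onI[OF continuous_on_cnj[OF continuous_on_id]]]
  by simp

lemma cvec_sum: "cvec (\<Sum>k\<in>S. X k) = (\<Sum>k\<in>S. cvec (X k))"
  by (simp add: cvec_def vec_eq_iff sum_component)

lemma cvec_mult_adj: "cvec (P ** X ** cmat_adj R) = kron (cmat_conj R) P *v cvec X"
proof -
  have "cvec (P ** X ** cmat_adj R) $ (p, q) = (kron (cmat_conj R) P *v cvec X) $ (p, q)" for p q
  proof -
    have "cvec (P ** X ** cmat_adj R) $ (p, q) = (\<Sum>c\<in>UNIV. \<Sum>e\<in>UNIV. cnj (R $ p $ c) * P $ q $ e * X $ e $ c)"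
      by (simp add: cvec_def cmat_adj_def matrix_matrix_mult_def sum_distrib_left mult_ac)
    also have "\<dots> = (\<Sum>ce\<in>UNIV. cnj (R $ p $ fst ce) * P $ q $ snd ce * X $ snd ce $ fst ce)"
      by (simp add: sum.cartesian_product case_prod_beta flip: UNIV_Times_UNIV)
    also have "\<dots> = (kron (cmat_conj R) P *v cvec X) $ (p, q)"
      by (simp add: matrix_vector_mult_def kron_def cmat_conj_def cvec_def)
    finally show ?thesis .
  qed
  then show ?thesis
    by (simp add: vec_eq_iff)
qed

lemma integrable_matrix_vector_mult_entries:
  fixes x y :: "'a \<Rightarrow> complex^'d"
  assumes "\<And>a b. integrable M (\<lambda>\<omega>. x \<omega> $ a * cnj (y \<omega> $ b))"
  shows "integrable M (\<lambda>\<omega>. (P *v x \<omega>) $ i * cnj ((R *v y \<omega>) $ j))"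
    and "integral\<^sup>L M (\<lambda>\<omega>. (P *v x \<omega>) $ i * cnj ((R *v y \<omega>) $ j))
      = (\<Sum>a\<in>UNIV. \<Sum>b\<in>UNIV. P $ i $ a * cnj (R $ j $ b) * covmat M x y $ a $ b)"
proof -
  have expand: "(\<lambda>\<omega>. (P *v x \<omega>) $ i * cnj ((R *v y \<omega>) $ j))
      = (\<lambda>\<omega>. \<Sum>a\<in>UNIV. \<Sum>b\<in>UNIV. (P $ i $ a * cnj (R $ j $ b)) * (x \<omega> $ a * cnj (y \<omega> $ b)))"
    unfolding matrix_vector_mult_def
    by (simp add: sum_distrib_left sum_distrib_right mult_ac) (rule ext, rule sum.swap)
  show "integrable M (\<lambda>\<omega>. (P *v x \<omega>) $ i * cnj ((R *v y \<omega>) $ j))"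
    unfolding expand using assms by simp
  show "integral\<^sup>L M (\<lambda>\<omega>. (P *v x \<omega>) $ i * cnj ((R *v y \<omega>) $ j))
      = (\<Sum>a\<in>UNIV. \<Sum>b\<in>UNIV. P $ i $ a * cnj (R $ j $ b) * covmat M x y $ a $ b)"
    unfolding expand covmat_def using assms by (simp add: integral_sum)
qed

lemma covmat_matrix_vector_mult:
  fixes x y :: "'a \<Rightarrow> complex^'d"
  assumes "\<And>a b. integrable M (\<lambda>\<omega>. x \<omega> $ a * cnj (y \<omega> $ b))"
  shows "covmat M (\<lambda>\<omega>. P *v x \<omega>) (\<lambda>\<omega>. R *v y \<omega>) = P ** covmat M x y ** cmat_adj R"
proof -
  have "covmat M (\<lambda>\<omega>. P *v x \<omega>) (\<lambda>\<omega>. R *v y \<omega>) $ i $ j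
      = (P ** covmat M x y ** cmat_adj R) $ i $ j" for i j
    unfolding covmat_def[of M "\<lambda>\<omega>. P *v x \<omega>"]
    by (simp add: integrable_matrix_vector_mult_entries(2)[OF assms] matrix_matrix_mult_def
        cmat_adj_def sum_distrib_left mult_ac) (rule sum.swap)
  then show ?thesis
    by (simp add: vec_eq_iff)
qed

lemma integral_norm_sq_eq_Re_trace_covmat:
  fixes x :: "'a \<Rightarrow> complex^'d"
  assumes "\<And>a b. integrable M (\<lambda>\<omega>. x \<omega> $ a * cnj (x \<omega> $ b))"
  shows "integrable M (\<lambda>\<omega>. (norm (x \<omega>))\<^sup>2)"
    and "integral\<^sup>L M (\<lambda>\<omega>. (norm (x \<omega>))\<^sup>2) = Re (\<Sum>i\<in>UNIV. covmat M x x $ i $ i)"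
proof -
  have norm_sq: "complex_of_real ((norm (x \<omega>))\<^sup>2) = (\<Sum>i\<in>UNIV. x \<omega> $ i * cnj (x \<omega> $ i))" for \<omega>
    using cinner_self[of "x \<omega>"] by (simp add: cinner_def mult.commute)
  have int: "integrable M (\<lambda>\<omega>. complex_of_real ((norm (x \<omega>))\<^sup>2))"
    unfolding norm_sq using assms by simp
  show "integrable M (\<lambda>\<omega>. (norm (x \<omega>))\<^sup>2)"
    using integrable_Re[OF int] by simp
  have "integral\<^sup>L M (\<lambda>\<omega>. (norm (x \<omega>))\<^sup>2) = Re (integral\<^sup>L M (\<lambda>\<omega>. complex_of_real ((norm (x \<omega>))\<^sup>2)))"
    by (simp only: integral_complex_of_real Re_complex_of_real)
  also have "\<dots> = Re (\<Sum>i\<in>UNIV. covmat M x x $ i $ i)"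
    unfolding norm_sq covmat_def using assms by (simp add: integral_sum)
  finally show "integral\<^sup>L M (\<lambda>\<omega>. (norm (x \<omega>))\<^sup>2) = Re (\<Sum>i\<in>UNIV. covmat M x x $ i $ i)" .
qed

lemma (in prob_space) indep_vars_integral_mult:
  fixes X :: "'i \<Rightarrow> 'a \<Rightarrow> real"
    and f g :: "('i \<Rightarrow> real) \<Rightarrow> 'b::{real_normed_field, banach, second_countable_topology}"
  assumes "indep_vars (\<lambda>_. borel) X I" and "J1 \<inter> J2 = {}" "J1 \<subseteq> I" "J2 \<subseteq> I"
    and "f \<in> borel_measurable (PiM J1 (\<lambda>_. borel))" "g \<in> borel_measurable (PiM J2 (\<lambda>_. borel))"
    and "\<And>\<omega>. F \<omega> = f (restrict (\<lambda>i. X i \<omega>) J1)" "\<And>\<omega>. G \<omega> = g (restrict (\<lambda>i. X i \<omega>) J2)"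
    and "integrable M F" "integrable M G"
  shows "integrable M (\<lambda>\<omega>. F \<omega> * G \<omega>)"
    and "integral\<^sup>L M (\<lambda>\<omega>. F \<omega> * G \<omega>) = integral\<^sup>L M F * integral\<^sup>L M G"
proof -
  have "indep_var borel (f \<circ> (\<lambda>\<omega>. restrict (\<lambda>i. X i \<omega>) J1)) borel (g \<circ> (\<lambda>\<omega>. restrict (\<lambda>i. X i \<omega>) J2))"
    using assms(1-6) by (intro indep_var_compose[OF indep_var_restrict])
  moreover have "f \<circ> (\<lambda>\<omega>. restrict (\<lambda>i. X i \<omega>) J1) = F" "g \<circ> (\<lambda>\<omega>. restrict (\<lambda>i. X i \<omega>) J2) = G"
    using assms(7,8) by (auto simp: fun_eq_iff)
  ultimately have "indep_var borel F borel G"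
    by simp
  then show "integrable M (\<lambda>\<omega>. F \<omega> * G \<omega>)"
    and "integral\<^sup>L M (\<lambda>\<omega>. F \<omega> * G \<omega>) = integral\<^sup>L M F * integral\<^sup>L M G"
    using assms(9,10) by (simp_all add: indep_var_integrable indep_var_lebesgue_integral)
qed

section \<open>The recursion driven by unit-variance noise\<close>

(* Index 0 absorbs the drift: \<xi>_{n,0} = 1 and B_0 = A. *)
definition aug_mat :: "complex^'d^'d \<Rightarrow> (nat \<Rightarrow> complex^'d^'d) \<Rightarrow> nat \<Rightarrow> complex^'d^'d" where
  "aug_mat A B k = (if k = 0 then A else B k)"

definition aug_noise :: "(nat \<Rightarrow> nat \<Rightarrow> 'a \<Rightarrow> real) \<Rightarrow> nat \<Rightarrow> nat \<Rightarrow> 'a \<Rightarrow> real" where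
  "aug_noise \<xi> n k \<omega> = (if k = 0 then 1 else \<xi> n k \<omega>)"

lemma sum_atLeast0_atMost_split: "(\<Sum>k\<in>{0..m::nat}. f k) = f 0 + (\<Sum>k\<in>{1..m}. f k)"
  using sum.atLeast_Suc_atMost[of 0 m f] by simp

lemma traj_Suc_aug:
  "traj A B m \<xi> u (Suc n) \<omega>
     = (\<Sum>k\<in>{0..m}. of_real (aug_noise \<xi> (Suc n) k \<omega>) *s (aug_mat A B k *v traj A B m \<xi> u n \<omega>))"
proof -
  have "(\<Sum>k\<in>{1..m}. of_real (aug_noise \<xi> (Suc n) k \<omega>) *s (aug_mat A B k *v traj A B m \<xi> u n \<omega>))
      = (\<Sum>k\<in>{1..m}. of_real (\<xi> (Suc n) k \<omega>) *s (B k *v traj A B m \<xi> u n \<omega>))"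
    by (intro sum.cong) (auto simp: aug_noise_def[abs_def] aug_mat_def)
  then show ?thesis
    by (simp add: sum_atLeast0_atMost_split aug_noise_def[abs_def] aug_mat_def)
qed

lemma sum_aug_mat: "(\<Sum>k\<in>{0..m}. f (aug_mat A B k)) = f A + (\<Sum>k\<in>{1..m}. f (B k))"
  by (simp add: sum_atLeast0_atMost_split aug_mat_def)

lemma traj_cong:
  assumes "\<And>j k. 1 \<le> j \<Longrightarrow> j \<le> n \<Longrightarrow> k \<in> {1..m} \<Longrightarrow> \<xi> j k \<omega> = \<xi>' j k \<omega>'"
  shows "traj A B m \<xi> u n \<omega> = traj A B m \<xi>' u n \<omega>'"
  using assms by (induction n) auto

lemma traj_component_measurable:
  assumes "\<And>j k. 1 \<le> j \<Longrightarrow> j \<le> n \<Longrightarrow> k \<in> {1..m} \<Longrightarrow> \<xi> j k \<in> borel_measurable N"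
  shows "(\<lambda>\<omega>. traj A B m \<xi> u n \<omega> $ i) \<in> borel_measurable N"
  using assms
proof (induction n arbitrary: i)
  case (Suc n)
  have "(\<lambda>\<omega>. traj A B m \<xi> u n \<omega> $ a) \<in> borel_measurable N" for a
    using Suc.prems by (intro Suc.IH) auto
  then have "(\<lambda>\<omega>. (P *v traj A B m \<xi> u n \<omega>) $ a) \<in> borel_measurable N" for P a
    by (simp add: matrix_vector_mult_def)
  moreover have "\<xi> (Suc n) k \<in> borel_measurable N" if "k \<in> {1..m}" for k
    using Suc.prems that by auto
  ultimately show ?case
    by (simp del: atLeastAtMost_iff)
      (intro borel_measurable_add borel_measurable_sum borel_measurable_times borel_measurable_of_real;
       auto)
qed simp

lemma aug_noise_coordinate_measurable:
  assumes "k \<in> {0..m}"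
  shows "aug_noise (\<lambda>j k z. z (j, k)) n k \<in> borel_measurable (PiM ({n} \<times> {1..m}) (\<lambda>_. borel))"
proof (cases "k = 0")
  case False
  with assms have "(n, k) \<in> {n} \<times> {1..m}"
    by auto
  then have "(\<lambda>z. z (n, k)) \<in> borel_measurable (PiM ({n} \<times> {1..m}) (\<lambda>_. borel))"
    by (rule measurable_component_singleton)
  with False show ?thesis
    by (simp add: aug_noise_def[abs_def])
qed (simp add: aug_noise_def[abs_def])

locale unit_variance_noise = prob_space M for M :: "'a measure" +
  fixes m :: nat and \<xi> :: "nat \<Rightarrow> nat \<Rightarrow> 'a \<Rightarrow> real"
  assumes indep_noise: "indep_vars (\<lambda>_. borel) (\<lambda>(n, k). \<xi> n k) ({1..} \<times> {1..m})"
    and noise_measurable: "\<And>n k. n \<ge> 1 \<Longrightarrow> k \<in> {1..m} \<Longrightarrow> \<xi> n k \<in> borel_measurable M"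
    and noise_square_integrable: "\<And>n k. n \<ge> 1 \<Longrightarrow> k \<in> {1..m} \<Longrightarrow> integrable M (\<lambda>\<omega>. (\<xi> n k \<omega>)\<^sup>2)"
    and noise_mean: "\<And>n k. n \<ge> 1 \<Longrightarrow> k \<in> {1..m} \<Longrightarrow> integral\<^sup>L M (\<xi> n k) = 0"
    and noise_second_moment: "\<And>n k. n \<ge> 1 \<Longrightarrow> k \<in> {1..m} \<Longrightarrow> integral\<^sup>L M (\<lambda>\<omega>. (\<xi> n k \<omega>)\<^sup>2) = 1"
begin

lemma noise_integrable: "n \<ge> 1 \<Longrightarrow> k \<in> {1..m} \<Longrightarrow> integrable M (\<xi> n k)"
  using square_integrable_imp_integrable[OF noise_measurable noise_square_integrable] by auto

lemma aug_noise_restrict: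
  assumes "k \<in> {0..m}"
  shows "aug_noise \<xi> n k \<omega> = aug_noise (\<lambda>j k z. z (j, k)) n k (restrict (\<lambda>i. case_prod \<xi> i \<omega>) ({n} \<times> {1..m}))"
  using assms by (simp add: aug_noise_def[abs_def])

lemma aug_noise_moments:
  assumes "n \<ge> 1" and "k \<in> {0..m}" "l \<in> {0..m}"
  shows "integrable M (\<lambda>\<omega>. aug_noise \<xi> n k \<omega> * aug_noise \<xi> n l \<omega>)"
    and "integral\<^sup>L M (\<lambda>\<omega>. aug_noise \<xi> n k \<omega> * aug_noise \<xi> n l \<omega>) = (if k = l then 1 else 0)"
proof -
  have one_zero: "integrable M (aug_noise \<xi> n j) \<and> integral\<^sup>L M (aug_noise \<xi> n j) = (if j = 0 then 1 else 0)"
    if "j \<in> {0..m}" for j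
    using that assms(1) noise_integrable noise_mean by (auto simp: aug_noise_def[abs_def] prob_space)
  have "integrable M (\<lambda>\<omega>. aug_noise \<xi> n k \<omega> * aug_noise \<xi> n l \<omega>)
      \<and> integral\<^sup>L M (\<lambda>\<omega>. aug_noise \<xi> n k \<omega> * aug_noise \<xi> n l \<omega>) = (if k = l then 1 else 0)"
  proof (cases "k = 0 \<or> l = 0")
    case True
    then show ?thesis
      using one_zero[OF assms(2)] one_zero[OF assms(3)]
      by (auto simp: aug_noise_def[abs_def])
  next
    case False
    show ?thesis
    proof (cases "k = l")
      case True
      then show ?thesis
        using False assms noise_square_integrable noise_second_moment
        by (simp add: aug_noise_def[abs_def] power2_eq_square)
    next
      case False
      let ?f = "\<lambda>j z. z (n, j) :: real"
      have "integrable M (\<lambda>\<omega>. \<xi> n k \<omega> * \<xi> n l \<omega>)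
          \<and> integral\<^sup>L M (\<lambda>\<omega>. \<xi> n k \<omega> * \<xi> n l \<omega>) = integral\<^sup>L M (\<xi> n k) * integral\<^sup>L M (\<xi> n l)"
        using indep_vars_integral_mult[OF indep_noise, of "{(n, k)}" "{(n, l)}" "?f k" "?f l" "\<xi> n k" "\<xi> n l"]
          False \<open>\<not> (k = 0 \<or> l = 0)\<close> assms noise_integrable
        by (auto intro: measurable_component_singleton)
      then show ?thesis
        using False \<open>\<not> (k = 0 \<or> l = 0)\<close> assms noise_mean by (simp add: aug_noise_def[abs_def])
    qed
  qed
  then show "integrable M (\<lambda>\<omega>. aug_noise \<xi> n k \<omega> * aug_noise \<xi> n l \<omega>)"
    and "integral\<^sup>L M (\<lambda>\<omega>. aug_noise \<xi> n k \<omega> * aug_noise \<xi> n l \<omega>) = (if k = l then 1 else 0)"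
    by auto
qed

lemma indep_next_noise_integral_mult:
  fixes f :: "(nat \<times> nat \<Rightarrow> real) \<Rightarrow> complex" and A :: "complex^'d^'d"
  assumes "f \<in> borel_measurable (PiM ({Suc n} \<times> {1..m}) (\<lambda>_. borel))"
    and "\<And>\<omega>. F \<omega> = f (restrict (\<lambda>i. case_prod \<xi> i \<omega>) ({Suc n} \<times> {1..m}))"
    and "integrable M F"
    and "\<And>a b. integrable M (\<lambda>\<omega>. traj A B m \<xi> u n \<omega> $ a * cnj (traj A B m \<xi> v n \<omega> $ b))"
  shows "integrable M (\<lambda>\<omega>. F \<omega> * ((P *v traj A B m \<xi> u n \<omega>) $ i * cnj ((R *v traj A B m \<xi> v n \<omega>) $ j)))"
    and "integral\<^sup>L M (\<lambda>\<omega>. F \<omega> * ((P *v traj A B m \<xi> u n \<omega>) $ i * cnj ((R *v traj A B m \<xi> v n \<omega>) $ j)))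
      = integral\<^sup>L M F * integral\<^sup>L M (\<lambda>\<omega>. (P *v traj A B m \<xi> u n \<omega>) $ i * cnj ((R *v traj A B m \<xi> v n \<omega>) $ j))"
proof -
  let ?past = "{1..n} \<times> {1..m}"
  \<comment> \<open>Running the recursion on the coordinate process exhibits the state as a function of the past.\<close>
  let ?coord = "\<lambda>j k z. z (j, k) :: real"
  define g where "g z = (P *v traj A B m ?coord u n z) $ i * cnj ((R *v traj A B m ?coord v n z) $ j)" for z
  have "(\<lambda>z. traj A B m ?coord w n z $ a) \<in> borel_measurable (PiM ?past (\<lambda>_. borel))" for w a
    by (rule traj_component_measurable) (auto intro: measurable_component_singleton)
  then have g_measurable: "g \<in> borel_measurable (PiM ?past (\<lambda>_. borel))"
    unfolding g_def matrix_vector_mult_def by simp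
  have g_past: "(P *v traj A B m \<xi> u n \<omega>) $ i * cnj ((R *v traj A B m \<xi> v n \<omega>) $ j)
      = g (restrict (\<lambda>i. case_prod \<xi> i \<omega>) ?past)" for \<omega>
  proof -
    have "traj A B m \<xi> w n \<omega> = traj A B m ?coord w n (restrict (\<lambda>i. case_prod \<xi> i \<omega>) ?past)" for w
      by (rule traj_cong) auto
    then show ?thesis
      by (simp add: g_def)
  qed
  note indep = indep_vars_integral_mult[OF indep_noise _ _ _ assms(1) g_measurable assms(2) g_past
      assms(3) integrable_matrix_vector_mult_entries(1)[OF assms(4)]]
  show "integrable M (\<lambda>\<omega>. F \<omega> * ((P *v traj A B m \<xi> u n \<omega>) $ i * cnj ((R *v traj A B m \<xi> v n \<omega>) $ j)))"
    by (rule indep(1)) auto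
  show "integral\<^sup>L M (\<lambda>\<omega>. F \<omega> * ((P *v traj A B m \<xi> u n \<omega>) $ i * cnj ((R *v traj A B m \<xi> v n \<omega>) $ j)))
      = integral\<^sup>L M F * integral\<^sup>L M (\<lambda>\<omega>. (P *v traj A B m \<xi> u n \<omega>) $ i * cnj ((R *v traj A B m \<xi> v n \<omega>) $ j))"
    by (rule indep(2)) auto
qed

lemma covmat_traj_Suc:
  fixes A :: "complex^'d^'d"
  assumes past: "\<And>a b. integrable M (\<lambda>\<omega>. traj A B m \<xi> u n \<omega> $ a * cnj (traj A B m \<xi> v n \<omega> $ b))"
  shows "integrable M (\<lambda>\<omega>. traj A B m \<xi> u (Suc n) \<omega> $ a * cnj (traj A B m \<xi> v (Suc n) \<omega> $ b))"
    and "covmat M (traj A B m \<xi> u (Suc n)) (traj A B m \<xi> v (Suc n))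
      = (\<Sum>k\<in>{0..m}. covmat M (\<lambda>\<omega>. aug_mat A B k *v traj A B m \<xi> u n \<omega>)
                              (\<lambda>\<omega>. aug_mat A B k *v traj A B m \<xi> v n \<omega>))"
proof -
  let ?x = "traj A B m \<xi> u n" and ?y = "traj A B m \<xi> v n"
  let ?coord = "\<lambda>j k z. z (j, k) :: real"
  define \<eta> where "\<eta> k \<omega> = aug_noise \<xi> (Suc n) k \<omega>" for k \<omega>
  define G where "G a b k l \<omega> = (aug_mat A B k *v ?x \<omega>) $ a * cnj ((aug_mat A B l *v ?y \<omega>) $ b)"
    for a b k l \<omega>
  have expand: "traj A B m \<xi> u (Suc n) \<omega> $ a * cnj (traj A B m \<xi> v (Suc n) \<omega> $ b)
      = (\<Sum>k\<in>{0..m}. \<Sum>l\<in>{0..m}. of_real (\<eta> k \<omega> * \<eta> l \<omega>) * G a b k l \<omega>)" for a b \<omega>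
    unfolding traj_Suc_aug
    by (simp add: sum_component sum_product \<eta>_def G_def mult_ac)
  have "integrable M (\<lambda>\<omega>. of_real (\<eta> k \<omega> * \<eta> l \<omega>) * G a b k l \<omega>)
      \<and> integral\<^sup>L M (\<lambda>\<omega>. of_real (\<eta> k \<omega> * \<eta> l \<omega>) * G a b k l \<omega>)
          = (if k = l then integral\<^sup>L M (G a b k k) else 0)"
    if "k \<in> {0..m}" "l \<in> {0..m}" for a b k l
  proof -
    let ?f = "\<lambda>z. complex_of_real (aug_noise ?coord (Suc n) k z * aug_noise ?coord (Suc n) l z)"
    have f: "?f \<in> borel_measurable (PiM ({Suc n} \<times> {1..m}) (\<lambda>_. borel))"
      using aug_noise_coordinate_measurable[OF that(1)] aug_noise_coordinate_measurable[OF that(2)]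
      by measurable
    have F: "of_real (\<eta> k \<omega> * \<eta> l \<omega>) = ?f (restrict (\<lambda>i. case_prod \<xi> i \<omega>) ({Suc n} \<times> {1..m}))" for \<omega>
      using aug_noise_restrict[OF that(1)] aug_noise_restrict[OF that(2)] by (simp add: \<eta>_def)
    have "integrable M (\<lambda>\<omega>. complex_of_real (\<eta> k \<omega> * \<eta> l \<omega>))"
      unfolding \<eta>_def using that by (intro integrable_of_real aug_noise_moments(1)) auto
    note indep = indep_next_noise_integral_mult[OF f F this past, of "aug_mat A B k" a "aug_mat A B l" b]
    have "integral\<^sup>L M (\<lambda>\<omega>. complex_of_real (\<eta> k \<omega> * \<eta> l \<omega>)) = (if k = l then 1 else 0)"
      unfolding \<eta>_def integral_complex_of_real using aug_noise_moments(2)[of "Suc n" k l] that by simp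
    with indep show ?thesis
      by (simp add: G_def[abs_def])
  qed
  then have term_integrable: "integrable M (\<lambda>\<omega>. of_real (\<eta> k \<omega> * \<eta> l \<omega>) * G a b k l \<omega>)"
    and term_integral: "integral\<^sup>L M (\<lambda>\<omega>. of_real (\<eta> k \<omega> * \<eta> l \<omega>) * G a b k l \<omega>)
          = (if k = l then integral\<^sup>L M (G a b k k) else 0)"
    if "k \<in> {0..m}" "l \<in> {0..m}" for a b k l
    using that by blast+
  show "integrable M (\<lambda>\<omega>. traj A B m \<xi> u (Suc n) \<omega> $ a * cnj (traj A B m \<xi> v (Suc n) \<omega> $ b))"
    unfolding expand by (intro Bochner_Integration.integrable_sum term_integrable)
  have row_integrable: "integrable M (\<lambda>\<omega>. \<Sum>l\<in>{0..m}. of_real (\<eta> k \<omega> * \<eta> l \<omega>) * G a b k l \<omega>)"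
    if "k \<in> {0..m}" for a b k
    using that by (intro Bochner_Integration.integrable_sum term_integrable)
  have "covmat M (traj A B m \<xi> u (Suc n)) (traj A B m \<xi> v (Suc n)) $ a $ b
      = (\<Sum>k\<in>{0..m}. integral\<^sup>L M (\<lambda>\<omega>. \<Sum>l\<in>{0..m}. of_real (\<eta> k \<omega> * \<eta> l \<omega>) * G a b k l \<omega>))"
    for a b
    unfolding covmat_def expand vec_lambda_beta
    by (rule Bochner_Integration.integral_sum) (rule row_integrable)
  also have "\<dots> a b = (\<Sum>k\<in>{0..m}. \<Sum>l\<in>{0..m}. integral\<^sup>L M (\<lambda>\<omega>. of_real (\<eta> k \<omega> * \<eta> l \<omega>) * G a b k l \<omega>))"
    for a b
    by (intro sum.cong refl Bochner_Integration.integral_sum term_integrable) auto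
  also have "\<dots> a b = (\<Sum>k\<in>{0..m}. integral\<^sup>L M (G a b k k))" for a b
  proof (rule sum.cong[OF refl])
    fix k assume k: "k \<in> {0..m}"
    then have "(\<Sum>l\<in>{0..m}. integral\<^sup>L M (\<lambda>\<omega>. of_real (\<eta> k \<omega> * \<eta> l \<omega>) * G a b k l \<omega>))
        = (\<Sum>l\<in>{0..m}. if k = l then integral\<^sup>L M (G a b k k) else 0)"
      by (intro sum.cong refl term_integral) auto
    with k show "(\<Sum>l\<in>{0..m}. integral\<^sup>L M (\<lambda>\<omega>. of_real (\<eta> k \<omega> * \<eta> l \<omega>) * G a b k l \<omega>))
        = integral\<^sup>L M (G a b k k)"
      by simp
  qed
  finally show "covmat M (traj A B m \<xi> u (Suc n)) (traj A B m \<xi> v (Suc n))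
      = (\<Sum>k\<in>{0..m}. covmat M (\<lambda>\<omega>. aug_mat A B k *v ?x \<omega>) (\<lambda>\<omega>. aug_mat A B k *v ?y \<omega>))"
    by (simp add: vec_eq_iff sum_component covmat_def G_def[abs_def])
qed

lemma traj_products_integrable:
  "integrable M (\<lambda>\<omega>. traj A B m \<xi> u n \<omega> $ a * cnj (traj A B m \<xi> v n \<omega> $ b))"
proof (induction n arbitrary: a b)
  case (Suc n)
  show ?case
    by (rule covmat_traj_Suc(1)) (rule Suc.IH)
qed simp

lemma cvec_covmat_traj_Suc:
  "cvec (covmat M (traj A B m \<xi> u (Suc n)) (traj A B m \<xi> v (Suc n)))
    = (\<Sum>k\<in>{0..m}. kron (cmat_conj (aug_mat A B k)) (aug_mat A B k))
        *v cvec (covmat M (traj A B m \<xi> u n) (traj A B m \<xi> v n))"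
  by (simp add: covmat_traj_Suc(2)[OF traj_products_integrable]
      covmat_matrix_vector_mult[OF traj_products_integrable] cvec_sum cvec_mult_adj
      matrix_vector_mult_sum_left)

lemma second_moment_traj_Suc:
  fixes A :: "complex^'d^'d" and B :: "nat \<Rightarrow> complex^'d^'d"
  defines "N \<equiv> \<Sum>k\<in>{0..m}. cmat_adj (aug_mat A B k) ** aug_mat A B k"
  shows "integrable M (\<lambda>\<omega>. (norm (traj A B m \<xi> u n \<omega>))\<^sup>2)"
    and "integrable M (\<lambda>\<omega>. cquad_form N (traj A B m \<xi> u n \<omega>))"
    and "integral\<^sup>L M (\<lambda>\<omega>. (norm (traj A B m \<xi> u (Suc n) \<omega>))\<^sup>2)
      = integral\<^sup>L M (\<lambda>\<omega>. cquad_form N (traj A B m \<xi> u n \<omega>))"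
proof -
  let ?x = "traj A B m \<xi> u n"
  let ?Cx = "\<lambda>k \<omega>. aug_mat A B k *v ?x \<omega>"
  have Cx: "\<And>a b. integrable M (\<lambda>\<omega>. ?Cx k \<omega> $ a * cnj (?Cx k \<omega> $ b))" for k
    by (rule integrable_matrix_vector_mult_entries(1)[OF traj_products_integrable])
  note norm_sq_Cx = integral_norm_sq_eq_Re_trace_covmat[OF Cx]
  have quad: "cquad_form N (?x \<omega>) = (\<Sum>k\<in>{0..m}. (norm (?Cx k \<omega>))\<^sup>2)" for \<omega>
    by (simp add: N_def cquad_form_sum cquad_form_adj_mult_self)
  show "integrable M (\<lambda>\<omega>. (norm (?x \<omega>))\<^sup>2)"
    by (rule integral_norm_sq_eq_Re_trace_covmat(1)[OF traj_products_integrable])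
  show "integrable M (\<lambda>\<omega>. cquad_form N (?x \<omega>))"
    unfolding quad by (intro Bochner_Integration.integrable_sum norm_sq_Cx(1))
  have "integral\<^sup>L M (\<lambda>\<omega>. (norm (traj A B m \<xi> u (Suc n) \<omega>))\<^sup>2)
      = Re (\<Sum>i\<in>UNIV. covmat M (traj A B m \<xi> u (Suc n)) (traj A B m \<xi> u (Suc n)) $ i $ i)"
    by (rule integral_norm_sq_eq_Re_trace_covmat(2)[OF traj_products_integrable])
  also have "\<dots> = (\<Sum>k\<in>{0..m}. Re (\<Sum>i\<in>UNIV. covmat M (?Cx k) (?Cx k) $ i $ i))"
    by (simp add: covmat_traj_Suc(2)[OF traj_products_integrable] sum_component Re_sum
        sum.swap[of _ UNIV])
  also have "\<dots> = (\<Sum>k\<in>{0..m}. integral\<^sup>L M (\<lambda>\<omega>. (norm (?Cx k \<omega>))\<^sup>2))"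
    by (simp add: norm_sq_Cx(2))
  also have "\<dots> = integral\<^sup>L M (\<lambda>\<omega>. cquad_form N (?x \<omega>))"
    unfolding quad by (rule Bochner_Integration.integral_sum[symmetric]) (rule norm_sq_Cx(1))
  finally show "integral\<^sup>L M (\<lambda>\<omega>. (norm (traj A B m \<xi> u (Suc n) \<omega>))\<^sup>2)
      = integral\<^sup>L M (\<lambda>\<omega>. cquad_form N (?x \<omega>))" .
qed

end

lemma geometric_bounds_from_ratio_bounds:
  fixes r :: "nat \<Rightarrow> real"
  assumes "0 \<le> \<gamma>" "\<gamma> \<le> \<beta>" and "\<And>n. \<gamma> * r n \<le> r (Suc n)" "\<And>n. r (Suc n) \<le> \<beta> * r n"
  shows "r 0 * \<gamma> ^ n \<le> r n \<and> r n \<le> r 0 * \<beta> ^ n"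
proof (induction n)
  case (Suc n)
  have "r 0 * \<gamma> ^ Suc n \<le> \<gamma> * r n"
    using Suc assms(1) mult_left_mono by (fastforce simp: mult_ac)
  moreover have "\<beta> * r n \<le> r 0 * \<beta> ^ Suc n"
    using Suc assms(1,2) mult_left_mono by (fastforce simp: mult_ac)
  ultimately show ?case
    using assms(3,4)[of n] by linarith
qed simp

theorem proposition2p1:
  fixes M :: "'a measure"
    and A :: "complex^'d^'d" and B :: "nat \<Rightarrow> complex^'d^'d" and m :: nat
    and \<xi> :: "nat \<Rightarrow> nat \<Rightarrow> 'a \<Rightarrow> real"
    and u v :: "complex^'d"
  assumes "prob_space M"
    and "prob_space.indep_vars M (\<lambda>_. borel) (\<lambda>(n, k). \<xi> n k) ({1..} \<times> {1..m})"
    and "\<And>n k. n \<ge> 1 \<Longrightarrow> k \<in> {1..m} \<Longrightarrow> \<xi> n k \<in> borel_measurable M"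
    and "\<And>n k. n \<ge> 1 \<Longrightarrow> k \<in> {1..m} \<Longrightarrow> integrable M (\<lambda>\<omega>. (\<xi> n k \<omega>)\<^sup>2)"
    and "\<And>n k. n \<ge> 1 \<Longrightarrow> k \<in> {1..m} \<Longrightarrow> integral\<^sup>L M (\<xi> n k) = 0"
    and "\<And>n k. n \<ge> 1 \<Longrightarrow> k \<in> {1..m} \<Longrightarrow> integral\<^sup>L M (\<lambda>\<omega>. (\<xi> n k \<omega>)\<^sup>2) = 1"
  shows "(\<forall>n. cvec (covmat M (traj A B m \<xi> u n) (traj A B m \<xi> v n))
            = (((*v) (kron (cmat_conj A) A + (\<Sum>k\<in>{1..m}. kron (cmat_conj (B k)) (B k)))) ^^ n)
                (cvec (covmat M (traj A B m \<xi> u 0) (traj A B m \<xi> v 0))))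
         \<and> (\<forall>n. let N = cmat_adj A ** A + (\<Sum>k\<in>{1..m}. cmat_adj (B k) ** B k);
                 \<gamma> = Min (real_eigenvalues N); \<beta> = Max (real_eigenvalues N);
                 r = integral\<^sup>L M (\<lambda>\<omega>. (norm (traj A B m \<xi> u n \<omega>))\<^sup>2)
             in (norm u)\<^sup>2 * \<gamma> ^ n \<le> r \<and> r \<le> (norm u)\<^sup>2 * \<beta> ^ n)"
proof -
  interpret unit_variance_noise M m \<xi>
    using assms by (simp add: unit_variance_noise_def unit_variance_noise_axioms_def)
  let ?D = "kron (cmat_conj A) A + (\<Sum>k\<in>{1..m}. kron (cmat_conj (B k)) (B k))"
  let ?N = "cmat_adj A ** A + (\<Sum>k\<in>{1..m}. cmat_adj (B k) ** B k)"
  define r where "r n = integral\<^sup>L M (\<lambda>\<omega>. (norm (traj A B m \<xi> u n \<omega>))\<^sup>2)" for n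
  have cov: "cvec (covmat M (traj A B m \<xi> u n) (traj A B m \<xi> v n))
      = ((*v) ?D ^^ n) (cvec (covmat M (traj A B m \<xi> u 0) (traj A B m \<xi> v 0)))" for n
    by (induction n)
      (simp_all add: cvec_covmat_traj_Suc sum_aug_mat[where f = "\<lambda>C. kron (cmat_conj C) C"] del: traj.simps)
  define N where "N = (\<Sum>k\<in>{0..m}. cmat_adj (aug_mat A B k) ** aug_mat A B k)"
  have N_eq: "?N = N"
    unfolding N_def by (simp add: sum_aug_mat[where f = "\<lambda>C. cmat_adj C ** C"])
  note second_moment = second_moment_traj_Suc[of A B, folded N_def]
  have herm: "hermitian N"
    unfolding N_def by (intro hermitian_sum hermitian_adj_mult_self)
  have "0 \<le> Min (real_eigenvalues N)"
    using herm by (rule nonneg_Min_eigenvalue) (simp add: N_def cquad_form_sum cquad_form_adj_mult_self sum_nonneg)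
  moreover have "Min (real_eigenvalues N) * r n \<le> r (Suc n)" for n
    unfolding r_def second_moment(3) integral_mult_right_zero[symmetric]
    using second_moment(1,2) hermitian_Min_eigenvalue_le_cquad_form[OF herm]
    by (intro integral_mono) auto
  moreover have "r (Suc n) \<le> Max (real_eigenvalues N) * r n" for n
    unfolding r_def second_moment(3) integral_mult_right_zero[symmetric]
    using second_moment(1,2) hermitian_cquad_form_le_Max_eigenvalue[OF herm]
    by (intro integral_mono) auto
  ultimately have "r 0 * Min (real_eigenvalues N) ^ n \<le> r n \<and> r n \<le> r 0 * Max (real_eigenvalues N) ^ n"
    for n
    using hermitian_Min_le_Max_eigenvalue[OF herm] by (intro geometric_bounds_from_ratio_bounds)
  moreover have "r 0 = (norm u)\<^sup>2"
    unfolding r_def by (simp add: prob_space)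
  ultimately have "(norm u)\<^sup>2 * Min (real_eigenvalues N) ^ n \<le> r n
      \<and> r n \<le> (norm u)\<^sup>2 * Max (real_eigenvalues N) ^ n" for n
    by simp
  with cov show ?thesis
    unfolding Let_def N_eq r_def by blast
qed

end
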